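(* Let $p_{C_1}(z,w)=(1+w^2)(1-z)^2-w(6+20z+6z^2)$. Then $$2\pi\,\mathrm{m}(p_{C_1})=16\,D\!\left((1+\sqrt2)i\right)+2\pi\log(1+\sqrt2),$$ and in particular $10\,v_{\mathrm{tet}}+2\,v_{\mathrm{oct}}<2\pi\,\mathrm{m}(p_{C_1})$.
   Context: Mahler measure: $\mathrm{m}(P)=\frac{1}{(2\pi i)^2}\int_{|z|=|w|=1}\log|P(z,w)|\frac{dz}{z}\frac{dw}{w}$. $D$ is the Bloch–Wigner dilogarithm $D(z)=\operatorname{Im}(\mathrm{Li}_2(z))+\arg(1-z)\log|z|$, $\mathrm{Li}_2(z)=-\int_0^z\frac{\log(1-t)}{t}dt$. $v_{\mathrm{tet}}=D(e^{i\pi/3})\approx1.01494$, $v_{\mathrm{oct}}=4D(i)\approx3.66386$. *)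

theory Defs
  imports "HOL-Complex_Analysis.Complex_Analysis"
begin

definition Li2 :: "complex \<Rightarrow> complex" where
  "Li2 z = - contour_integral (linepath 0 z) (\<lambda>t. Ln (1 - t) / t)"

definition BW :: "complex \<Rightarrow> real" where
  "BW z = Im (Li2 z) + Arg (1 - z) * ln (cmod z)"

definition mahler2 :: "(complex \<Rightarrow> complex \<Rightarrow> complex) \<Rightarrow> real" where
  "mahler2 P = (1 / (4 * pi^2)) *
     (LINT x|lborel. indicator ({0..2*pi} \<times> {0..2*pi}) x *
        ln (cmod (P (cis (fst x)) (cis (snd x)))))"

definition pC1 :: "complex \<Rightarrow> complex \<Rightarrow> complex" where
  "pC1 z w = (1 + w^2) * (1 - z)^2 - w * (6 + 20 * z + 6 * z^2)"

definition v_tet :: real where "v_tet = BW (cis (pi / 3))"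
definition v_oct :: real where "v_oct = 4 * BW \<i>"

end

(* On the torus |p(z,w)| = |A + B z|^2 with A = 2(sqrt 2 + v), B = 2(sqrt 2 - v) and
   v = |cos(phi/2)|, w = exp(i phi). Since |B| <= A, Jensen's formula in z leaves the integral of
   4 pi ln(2(sqrt 2 + v)) over phi. With r = sqrt 2 - 1 one has
   sqrt 2 + cos t = |1 + r exp(i t)|^2 / (2 r), and the integral of ln|1 + r exp(i t)| over a
   quarter circle is Im Li2(i r), since t -> Li2(-r exp(-i t)) has derivative i Ln(1 + r exp(-i t)).
   This gives 4 pi ln(1 + sqrt 2) + 16 Im Li2(i r), and the inversion formula for Im Li2(i y)
   turns it into the stated form. The inequality has a relative margin of about 0.6 percent, so
   short Taylor bounds of the arctangent integrals suffice. *)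
theory Submission
  imports Defs
begin

subsection \<open>The dilogarithm on the slit plane\<close>

text \<open>The plane cut along the real ray from 1 to infinity, on which \<open>Ln (1 - z)\<close>
  is analytic.\<close>

definition Li2_domain :: "complex set" where
  "Li2_domain = {z. 1 - z \<notin> \<real>\<^sub>\<le>\<^sub>0}"

text \<open>The value 1 fills the removable singularity at 0, where the bare quotient would default
  to 0.\<close>

definition Li2_deriv :: "complex \<Rightarrow> complex" where
  "Li2_deriv z = (if z = 0 then 1 else - Ln (1 - z) / z)"

lemma Li2_domainI_Re:
  assumes "Re z < 1"
  shows "z \<in> Li2_domain"
  using assms by (auto simp: Li2_domain_def complex_nonpos_Reals_iff)

lemma Li2_domainI_Im:
  assumes "Im z \<noteq> 0"
  shows "z \<in> Li2_domain"
  using assms by (auto simp: Li2_domain_def complex_nonpos_Reals_iff)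

lemma Li2_domainI_norm:
  assumes "cmod z < 1"
  shows "z \<in> Li2_domain"
  using assms complex_Re_le_cmod[of z] by (intro Li2_domainI_Re) linarith

lemma open_Li2_domain: "open Li2_domain"
proof -
  have "Li2_domain = (\<lambda>z. 1 - z) -` (- \<real>\<^sub>\<le>\<^sub>0)"
    by (auto simp: Li2_domain_def)
  moreover have "open \<dots>"
    by (intro open_vimage open_Compl closed_nonpos_Reals_complex continuous_intros)
  ultimately show ?thesis by simp
qed

text \<open>Starlikeness about 0: the segment to a nonreal point meets the real axis only at 0, and
  the segment to a real point stays below 1. This lets the straight path in \<open>Li2\<close> be
  compared with a primitive.\<close>

lemma Li2_domain_closed_segment:
  assumes "z \<in> Li2_domain"
  shows "closed_segment 0 z \<subseteq> Li2_domain"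
proof
  fix x assume "x \<in> closed_segment 0 z"
  then obtain u where u: "0 \<le> u" "u \<le> 1" "x = of_real u * z"
    by (auto simp: in_segment scaleR_conv_of_real)
  show "x \<in> Li2_domain"
  proof (cases "Im z = 0")
    case True
    then have "Re z < 1"
      using assms by (auto simp: Li2_domain_def complex_nonpos_Reals_iff)
    moreover have "u * Re z \<le> max 0 (Re z)"
      using u by (smt (verit) mult_left_le_one_le mult_nonneg_nonpos)
    ultimately show ?thesis
      using u by (intro Li2_domainI_Re) auto
  next
    case False
    then show ?thesis
      using u by (cases "u = 0") (auto intro: Li2_domainI_Re Li2_domainI_Im)
  qed
qed

lemma isCont_Li2_deriv:
  assumes "z \<in> Li2_domain"
  shows "isCont Li2_deriv z"
proof (cases "z = 0")
  case True
  \<comment> \<open>The quotient below is the difference quotient of \<open>Ln (1 - t)\<close> at 0,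
    so its limit is this derivative.\<close>
  have "((\<lambda>t. Ln (1 - t)) has_field_derivative -1) (at 0)"
    by (auto intro!: derivative_eq_intros)
  then have "((\<lambda>t. Ln (1 - t) / t) \<longlongrightarrow> -1) (at 0)"
    by (simp add: has_field_derivative_iff)
  from tendsto_minus[OF this] have "((\<lambda>t. - Ln (1 - t) / t) \<longlongrightarrow> 1) (at 0)"
    by simp
  then have "(Li2_deriv \<longlongrightarrow> 1) (at 0)"
    by (rule Lim_transform_eventually)
       (auto simp: Li2_deriv_def eventually_at_filter)
  then show ?thesis
    using True by (simp add: isCont_def Li2_deriv_def)
next
  case False
  have "isCont (\<lambda>t. - Ln (1 - t) / t) z"
    using assms False by (auto simp: Li2_domain_def intro!: continuous_intros)
  moreover have "\<forall>\<^sub>F t in nhds z. Li2_deriv t = - Ln (1 - t) / t"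
    using t1_space_nhds[OF False] by eventually_elim (auto simp: Li2_deriv_def)
  ultimately show ?thesis
    by (simp add: isCont_cong)
qed

lemma field_differentiable_Li2_deriv:
  assumes "z \<in> Li2_domain - {0}"
  shows "Li2_deriv field_differentiable (at z)"
proof -
  obtain D where "((\<lambda>t. - Ln (1 - t) / t) has_field_derivative D) (at z)"
    using assms unfolding Li2_domain_def by (auto intro!: that derivative_eq_intros)
  moreover have "\<forall>\<^sub>F t in nhds z. Li2_deriv t = - Ln (1 - t) / t"
    using t1_space_nhds[of z 0] assms by (auto simp: Li2_deriv_def elim!: eventually_mono)
  ultimately show ?thesis
    by (auto simp: field_differentiable_def DERIV_cong_ev[OF refl _ refl])
qed

text \<open>On the starlike domain the integrand has a primitive F; integrating it along the segment
  from 0 identifies \<open>Li2\<close> with F - F 0.\<close>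

lemma has_field_derivative_Li2:
  assumes "z \<in> Li2_domain"
  shows "(Li2 has_field_derivative Li2_deriv z) (at z)"
proof -
  have 0: "0 \<in> Li2_domain"
    by (auto intro: Li2_domainI_Re)
  \<comment> \<open>The primitive theorem admits a finite exceptional set, here \<open>{0}\<close>,
    where continuity replaces differentiability.\<close>
  have "\<exists>F. \<forall>x\<in>Li2_domain. (F has_field_derivative Li2_deriv x) (at x)"
    by (rule holomorphic_starlike_primitive[where k = "{0}"])
       (use 0 Li2_domain_closed_segment in
         \<open>auto simp: starlike_def intro!: open_Li2_domain field_differentiable_Li2_deriv
            continuous_at_imp_continuous_on isCont_Li2_deriv\<close>)
  then obtain F where F: "\<And>x. x \<in> Li2_domain \<Longrightarrow> (F has_field_derivative Li2_deriv x) (at x)"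
    by blast
  have Li2_eq: "Li2 x = F x - F 0" if x: "x \<in> Li2_domain" for x
  proof (cases "x = 0")
    case True
    then show ?thesis by (simp add: Li2_def)
  next
    case False
    have "(Li2_deriv has_contour_integral (F x - F 0)) (linepath 0 x)"
      using contour_integral_primitive[of Li2_domain F Li2_deriv "linepath 0 x"]
        F Li2_domain_closed_segment[OF x] by (auto intro: has_field_derivative_at_within)
    then have "((\<lambda>u. Li2_deriv (linepath 0 x u) * x) has_integral (F x - F 0)) {0..1}"
      by (simp add: has_contour_integral_linepath)
    \<comment> \<open>The integrands differ only at u = 0, where the quotient defaults to 0 while
      \<open>Li2_deriv 0 = 1\<close>; one point is negligible.\<close>
    then have "((\<lambda>u. - (Ln (1 - linepath 0 x u) / linepath 0 x u) * x)
        has_integral (F x - F 0)) {0..1}"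
    proof (rule has_integral_spike[where S = "{0}", rotated 2])
      fix u :: real assume "u \<in> {0..1} - {0}"
      then have "linepath 0 x u \<noteq> 0"
        using False by (simp add: linepath_def)
      then show "- (Ln (1 - linepath 0 x u) / linepath 0 x u) * x = Li2_deriv (linepath 0 x u) * x"
        by (simp add: Li2_deriv_def)
    qed simp
    from has_integral_neg[OF this]
    have "((\<lambda>u. (Ln (1 - linepath 0 x u) / linepath 0 x u) * x)
        has_integral - (F x - F 0)) {0..1}"
      by (simp only: mult_minus_left minus_minus)
    then show ?thesis
      unfolding Li2_def
      by (subst contour_integral_unique[where i = "- (F x - F 0)"])
         (auto simp: has_contour_integral_linepath)
  qed
  have "((\<lambda>x. F x - F 0) has_field_derivative Li2_deriv z) (at z)"
    using F[OF assms] by (auto intro!: derivative_eq_intros)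
  moreover have "\<forall>\<^sub>F x in nhds z. Li2 x = F x - F 0"
    using eventually_nhds_in_open[OF open_Li2_domain assms]
    by eventually_elim (simp add: Li2_eq)
  ultimately show ?thesis
    by (simp add: DERIV_cong_ev[OF refl _ refl])
qed

lemma Li2_0 [simp]: "Li2 0 = 0"
  by (simp add: Li2_def)

lemma Li2_deriv_mult: "z * Li2_deriv z = - Ln (1 - z)"
  by (simp add: Li2_deriv_def)

text \<open>Along a circle the integrand is, up to the factor \<^term>\<open>- k\<close>, the derivative of the
  imaginary part of the dilogarithm, because \<^term>\<open>z * Li2_deriv z\<close> is \<^term>\<open>- Ln (1 - z)\<close>.\<close>

lemma has_integral_ln_cmod_one_minus_cis:
  fixes c :: complex and k :: real
  assumes c: "cmod c < 1" and k: "k \<noteq> 0" and "a \<le> b"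
  shows "((\<lambda>t. ln (cmod (1 - c * cis (k * t)))) has_integral
    (Im (Li2 (c * cis (k * a))) - Im (Li2 (c * cis (k * b)))) / k) {a..b}"
proof -
  define G where "G = (\<lambda>t. - Im (Li2 (c * cis (k * t))) / k)"
  have cis: "((\<lambda>t. cis (k * t)) has_vector_derivative (\<i> * k * cis (k * t))) (at t)" for t
  proof -
    have "((\<lambda>t. of_real (k * t)) has_vector_derivative of_real k) (at t)"
      by (intro has_vector_derivative_of_real) (auto intro!: derivative_eq_intros)
    then have "((\<lambda>t. \<i> * of_real (k * t)) has_vector_derivative (\<i> * of_real k)) (at t)"
      by (rule has_vector_derivative_mult_right)
    from field_vector_diff_chain_at[OF this DERIV_exp] show ?thesis
      by (simp add: o_def cis_conv_exp)
  qed
  have "((\<lambda>t. ln (cmod (1 - c * cis (k * t)))) has_integral (G b - G a)) {a..b}"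
  proof (rule fundamental_theorem_of_calculus[OF \<open>a \<le> b\<close>])
    fix t assume "t \<in> {a..b}"
    let ?z = "c * cis (k * t)"
    have dom: "cmod ?z < 1"
      using c by (simp add: norm_mult)
    have "((\<lambda>t. c * cis (k * t)) has_vector_derivative (c * (\<i> * k * cis (k * t)))) (at t)"
      by (intro has_vector_derivative_mult_right cis)
    from field_vector_diff_chain_at[OF this has_field_derivative_Li2[OF Li2_domainI_norm[OF dom]]]
    have "((\<lambda>t. Li2 (c * cis (k * t))) has_vector_derivative
        (c * (\<i> * k * cis (k * t)) * Li2_deriv ?z)) (at t)"
      by (simp add: o_def)
    also have "c * (\<i> * k * cis (k * t)) * Li2_deriv ?z = \<i> * k * (?z * Li2_deriv ?z)"
      by (simp add: algebra_simps)
    also have "\<dots> = - \<i> * k * Ln (1 - ?z)"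
      unfolding Li2_deriv_mult by simp
    \<comment> \<open>The imaginary part of -i k Ln u is -k ln |u| for nonzero u.\<close>
    finally have "((\<lambda>t. Im (Li2 (c * cis (k * t)))) has_vector_derivative
        (Im (- \<i> * k * Ln (1 - ?z)))) (at t)"
      by (rule bounded_linear.has_vector_derivative[OF bounded_linear_Im])
    moreover have "1 - ?z \<noteq> 0"
      using dom by auto
    ultimately have "((\<lambda>t. Im (Li2 (c * cis (k * t)))) has_vector_derivative
        (- (k * ln (cmod (1 - ?z))))) (at t)"
      by simp
    then have "((\<lambda>t. Im (Li2 (c * cis (k * t)))) has_real_derivative
        (- (k * ln (cmod (1 - ?z))))) (at t)"
      by (simp add: has_real_derivative_iff_has_vector_derivative)
    from DERIV_cdivide[OF DERIV_minus[OF this], of k]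
    have "(G has_real_derivative ln (cmod (1 - ?z))) (at t)"
      using k by (simp add: G_def)
    then show "(G has_vector_derivative ln (cmod (1 - ?z))) (at t within {a..b})"
      by (simp add: has_real_derivative_iff_has_vector_derivative has_vector_derivative_at_within)
  qed
  also have "G b - G a = (Im (Li2 (c * cis (k * a))) - Im (Li2 (c * cis (k * b)))) / k"
    by (simp add: G_def diff_divide_distrib)
  finally show ?thesis .
qed

section \<open>Imaginary part of the dilogarithm along rays\<close>

text \<open>The chain-rule factor c cancels against the denominator t c of the integrand, leaving
  -Ln (1 - t c) / t, and the imaginary part of \<open>Ln\<close> is \<open>Arg\<close>.\<close>

lemma has_real_derivative_Im_Li2_ray:
  fixes t :: real
  assumes "of_real t * c \<in> Li2_domain" "t \<noteq> 0"
  shows "((\<lambda>t. Im (Li2 (of_real t * c))) has_real_derivative - Arg (1 - of_real t * c) / t) (at t)"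
proof (cases "c = 0")
  case True
  then show ?thesis by simp
next
  case False
  have "((\<lambda>t. of_real t * c) has_vector_derivative c) (at t)"
    by (auto intro!: derivative_eq_intros)
  from field_vector_diff_chain_at[OF this has_field_derivative_Li2[OF assms(1)]]
  have "((\<lambda>t. Li2 (of_real t * c)) has_vector_derivative (c * Li2_deriv (of_real t * c))) (at t)"
    by (simp add: o_def)
  also have "c * Li2_deriv (of_real t * c) = - (Ln (1 - of_real t * c) / of_real t)"
    using assms(2) False by (simp add: Li2_deriv_def)
  finally have "((\<lambda>t. Im (Li2 (of_real t * c))) has_vector_derivative
      Im (- (Ln (1 - of_real t * c) / of_real t))) (at t)"
    by (rule bounded_linear.has_vector_derivative[OF bounded_linear_Im])
  moreover have "1 - of_real t * c \<noteq> 0"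
    using assms(1) by (auto simp: Li2_domain_def)
  ultimately show ?thesis
    by (simp add: has_real_derivative_iff_has_vector_derivative Arg_eq_Im_Ln)
qed

text \<open>The point t = 0 is allowed here, unlike in the derivative formula, so comparisons along
  a ray can start at the origin.\<close>

lemma continuous_on_Im_Li2_ray:
  assumes "\<And>t. t \<in> A \<Longrightarrow> of_real t * c \<in> Li2_domain"
  shows "continuous_on A (\<lambda>t. Im (Li2 (of_real t * c)))"
proof (rule continuous_at_imp_continuous_on, rule ballI)
  fix t assume "t \<in> A"
  then have "isCont Li2 (of_real t * c)"
    using has_field_derivative_Li2[OF assms] DERIV_isCont by blast
  then show "isCont (\<lambda>t. Im (Li2 (of_real t * c))) t"
    by (intro isCont_o2[where g = Li2, THEN isCont_Im] continuous_intros) auto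
qed

text \<open>Along the segment from 0 to x the number 1 - t x is positive, so its argument vanishes
  and the imaginary part stays constant.\<close>

lemma Im_Li2_real:
  fixes x :: real
  assumes "x < 1"
  shows "Im (Li2 (of_real x)) = 0"
proof (cases "x = 0")
  case True
  then show ?thesis by simp
next
  case False
  have dom: "of_real t * complex_of_real x \<in> Li2_domain" if "0 \<le> t" "t \<le> 1" for t :: real
    using that assms Li2_domain_closed_segment[OF Li2_domainI_Re[of "of_real x"]]
    by (auto simp: in_segment scaleR_conv_of_real subset_iff)
  have "Im (Li2 (of_real 1 * of_real x)) = Im (Li2 (of_real 0 * of_real x))"
  proof (rule DERIV_isconst_end[where f = "\<lambda>t. Im (Li2 (of_real t * of_real x))"])
    show "continuous_on {0..1} (\<lambda>t. Im (Li2 (of_real t * of_real x)))"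
      by (rule continuous_on_Im_Li2_ray) (use dom in auto)
    fix t :: real assume t: "0 < t" "t < 1"
    have "t * x < 1"
      using dom[of t] t by (auto simp: Li2_domain_def complex_nonpos_Reals_iff)
    then have "Arg (1 - of_real t * complex_of_real x) = 0"
      by (simp add: Arg_eq_0 complex_is_Real_iff)
    then show "((\<lambda>t. Im (Li2 (of_real t * of_real x))) has_real_derivative 0) (at t)"
      using has_real_derivative_Im_Li2_ray[OF dom, of t] t by simp
  qed auto
  then show ?thesis by simp
qed

lemma imaginary_in_Li2_domain [simp]: "of_real t * \<i> \<in> Li2_domain"
  by (intro Li2_domainI_Re) auto

lemma Arg_one_minus_imaginary: "Arg (1 - of_real t * \<i>) = - arctan t"
  by (subst arg_conv_arctan) (auto simp: arctan_minus)

text \<open>Thus on the imaginary axis Im Li2 is the inverse tangent integral.\<close>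

lemma has_real_derivative_Im_Li2_imaginary:
  fixes t :: real
  assumes "t \<noteq> 0"
  shows "((\<lambda>t. Im (Li2 (of_real t * \<i>))) has_real_derivative arctan t / t) (at t)"
  using has_real_derivative_Im_Li2_ray[of t \<i>] assms by (simp add: Arg_one_minus_imaginary)

subsection \<open>The Mahler measure\<close>

text \<open>The polynomial is palindromic in each variable, so on the torus it is
  \<open>cis \<theta> * cis \<phi>\<close> times a real number, and that number is minus a sum of
  two squares.\<close>

lemma cmod_pC1_cis:
  fixes \<theta> \<phi> :: real
  defines "v \<equiv> \<bar>cos (\<phi> / 2)\<bar>"
  shows "cmod (pC1 (cis \<theta>) (cis \<phi>)) =
    (cmod (of_real (2 * (sqrt 2 + v)) + of_real (2 * (sqrt 2 - v)) * cis \<theta>))\<^sup>2"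
proof -
  define c where "c = cos \<theta>"
  have sin2: "(sin x)\<^sup>2 = 1 - (cos x)\<^sup>2" for x :: real
    by (simp add: sin_squared_eq)
  have w: "1 + (cis \<phi>)\<^sup>2 = of_real (2 * cos \<phi>) * cis \<phi>"
    by (simp add: complex_eq_iff sin2 power2_eq_square algebra_simps flip: sin_cos_squared_add3)
  have z: "1 + (cis \<theta>)\<^sup>2 = of_real (2 * c) * cis \<theta>"
    by (simp add: c_def complex_eq_iff sin2 power2_eq_square algebra_simps flip: sin_cos_squared_add3)
  have "(1 - cis \<theta>)\<^sup>2 = (1 + (cis \<theta>)\<^sup>2) - 2 * cis \<theta>"
    by (simp add: power2_eq_square algebra_simps)
  also have "\<dots> = of_real (2 * c - 2) * cis \<theta>"
    unfolding z by (simp add: algebra_simps)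
  finally have z1: "(1 - cis \<theta>)\<^sup>2 = of_real (2 * c - 2) * cis \<theta>" .
  have "6 + 20 * cis \<theta> + 6 * (cis \<theta>)\<^sup>2 = 6 * (1 + (cis \<theta>)\<^sup>2) + 20 * cis \<theta>"
    by simp
  also have "\<dots> = of_real (12 * c + 20) * cis \<theta>"
    unfolding z by (simp add: algebra_simps)
  finally have z2: "6 + 20 * cis \<theta> + 6 * (cis \<theta>)\<^sup>2 = of_real (12 * c + 20) * cis \<theta>" .
  have "pC1 (cis \<theta>) (cis \<phi>) =
      of_real (2 * cos \<phi> * (2 * c - 2) - (12 * c + 20)) * (cis \<theta> * cis \<phi>)"
    unfolding pC1_def w z1 z2 by (simp add: algebra_simps)
  then have "cmod (pC1 (cis \<theta>) (cis \<phi>)) = \<bar>2 * cos \<phi> * (2 * c - 2) - (12 * c + 20)\<bar>"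
    by (simp only: norm_mult norm_of_real norm_cis mult_1_right)
  also have "cos \<phi> = 2 * v\<^sup>2 - 1"
    using cos_double_cos[of "\<phi> / 2"] by (simp add: v_def)
  \<comment> \<open>With A and B the two coefficients, this is -(A^2 + B^2 + 2 A B c), grouped into
    the squared real and imaginary parts of A + B cis \<theta>.\<close>
  also have "2 * (2 * v\<^sup>2 - 1) * (2 * c - 2) - (12 * c + 20) =
      - ((2 * (sqrt 2 + v) + 2 * (sqrt 2 - v) * c)\<^sup>2 + (2 * (sqrt 2 - v))\<^sup>2 * (1 - c\<^sup>2))"
    by (simp add: power2_eq_square algebra_simps)
  also have "1 - c\<^sup>2 = (sin \<theta>)\<^sup>2"
    by (simp add: c_def sin2)
  also have "\<bar>- ((2 * (sqrt 2 + v) + 2 * (sqrt 2 - v) * c)\<^sup>2 + (2 * (sqrt 2 - v))\<^sup>2 * (sin \<theta>)\<^sup>2)\<bar> =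
      (2 * (sqrt 2 + v) + 2 * (sqrt 2 - v) * c)\<^sup>2 + (2 * (sqrt 2 - v) * sin \<theta>)\<^sup>2"
    unfolding power_mult_distrib abs_minus by (intro abs_of_nonneg) simp
  also have "\<dots> = (cmod (of_real (2 * (sqrt 2 + v)) + of_real (2 * (sqrt 2 - v)) * cis \<theta>))\<^sup>2"
    by (simp add: cmod_power2 c_def)
  finally show ?thesis .
qed

text \<open>Since |A| + |B| = 4 sqrt 2 whatever v is, the bound is uniform; it supplies the constant
  \<open>ln 32\<close> used for Tonelli.\<close>

lemma cmod_pC1_cis_le: "cmod (pC1 (cis \<theta>) (cis \<phi>)) \<le> 32"
proof -
  let ?v = "\<bar>cos (\<phi> / 2)\<bar>"
  have "?v \<le> sqrt 2"
    by (rule order.trans[OF abs_cos_le_one]) simp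
  have "cmod (of_real (2 * (sqrt 2 + ?v)) + of_real (2 * (sqrt 2 - ?v)) * cis \<theta>) \<le>
      \<bar>2 * (sqrt 2 + ?v)\<bar> + \<bar>2 * (sqrt 2 - ?v)\<bar>"
    by (rule order.trans[OF norm_triangle_ineq]) (simp add: norm_mult del: of_real_mult of_real_add of_real_diff)
  also have "\<dots> = 4 * sqrt 2"
    using \<open>?v \<le> sqrt 2\<close> by (simp add: add_nonneg_nonneg)
  finally have "cmod (pC1 (cis \<theta>) (cis \<phi>)) \<le> (4 * sqrt 2)\<^sup>2"
    unfolding cmod_pC1_cis by (rule power_mono) simp
  then show ?thesis by (simp add: power_mult_distrib)
qed

text \<open>Jensen's formula: after factoring out A, the remaining integral over a full circle
  vanishes because the dilogarithm takes the same value at both ends.\<close>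

lemma has_integral_ln_cmod_linear_cis:
  fixes A B :: real
  assumes "\<bar>B\<bar> < A"
  shows "((\<lambda>\<theta>. ln (cmod (of_real A + of_real B * cis \<theta>))) has_integral 2 * pi * ln A) {0..2 * pi}"
proof -
  define c where "c = complex_of_real (- (B / A))"
  have "cmod c < 1"
    using assms by (simp add: c_def norm_divide)
  have eq: "ln (cmod (of_real A + of_real B * cis \<theta>)) = ln A + ln (cmod (1 - c * cis (1 * \<theta>)))" for \<theta>
  proof -
    have "of_real A + of_real B * cis \<theta> = of_real A * (1 - c * cis (1 * \<theta>))"
      using assms by (simp add: c_def field_simps)
    moreover have "cmod (c * cis (1 * \<theta>)) < 1"
      using \<open>cmod c < 1\<close> by (simp add: norm_mult)
    then have "1 - c * cis (1 * \<theta>) \<noteq> 0"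
      by auto
    ultimately show ?thesis
      using assms by (simp add: norm_mult ln_mult)
  qed
  show ?thesis
    unfolding eq
    using has_integral_add[OF has_integral_const_real[of "ln A" 0 "2 * pi"]
        has_integral_ln_cmod_one_minus_cis[OF \<open>cmod c < 1\<close>, of 1 0 "2 * pi"]]
    by simp
qed

text \<open>The hypothesis says v > 0, which makes |B| < A strict. The square in the modulus formula
  doubles Jensen's value.\<close>

lemma has_integral_ln_cmod_pC1:
  assumes "cos (\<phi> / 2) \<noteq> 0"
  shows "((\<lambda>\<theta>. ln (cmod (pC1 (cis \<theta>) (cis \<phi>)))) has_integral
    4 * pi * (ln 2 + ln (sqrt 2 + \<bar>cos (\<phi> / 2)\<bar>))) {0..2 * pi}"
proof -
  define v where "v = \<bar>cos (\<phi> / 2)\<bar>"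
  have v: "0 < v"
    using assms by (simp add: v_def)
  have "v \<le> sqrt 2"
    unfolding v_def by (rule order.trans[OF abs_cos_le_one]) simp
  then have "\<bar>2 * (sqrt 2 - v)\<bar> < 2 * (sqrt 2 + v)"
    using v by (simp add: abs_mult)
  from has_integral_mult_right[OF has_integral_ln_cmod_linear_cis[OF this], of 2]
  have "((\<lambda>\<theta>. ln (cmod (pC1 (cis \<theta>) (cis \<phi>)))) has_integral
      2 * (2 * pi * ln (2 * (sqrt 2 + v)))) {0..2 * pi}"
    unfolding cmod_pC1_cis v_def[symmetric] ln_realpow by simp
  also have "ln (2 * (sqrt 2 + v)) = ln 2 + ln (sqrt 2 + v)"
    using v by (intro ln_mult_pos) (auto intro: add_pos_pos)
  finally show ?thesis
    by (simp add: v_def mult.assoc)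
qed

section \<open>The outer integral\<close>

text \<open>The radius r = sqrt 2 - 1 solves r^2 + 2 r = 1, that is (1 + r^2) / (2 r) = sqrt 2, so
  dividing |1 + r cis x|^2 by 2 r gives sqrt 2 + cos x.\<close>

lemma ln_sqrt2_plus_cos:
  "ln (sqrt 2 + cos x) = ln ((1 + sqrt 2) / 2) + 2 * ln (cmod (1 + of_real (sqrt 2 - 1) * cis x))"
proof -
  define r where "r = sqrt 2 - 1"
  have r: "r\<^sup>2 = 1 - 2 * r" "0 < r" "r < 1"
    by (auto simp: r_def power2_eq_square algebra_simps sqrt2_less_2 less_diff_eq)
  have y: "1 + sqrt 2 = r + 2" by (simp add: r_def)
  have n: "(cmod (1 + of_real r * cis x))\<^sup>2 = 1 + r\<^sup>2 + 2 * r * cos x"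
  proof -
    have "(cmod (1 + of_real r * cis x))\<^sup>2 = (1 + r * cos x)\<^sup>2 + (r * sin x)\<^sup>2"
      by (simp add: cmod_power2)
    also have "\<dots> = 1 + 2 * r * cos x + r\<^sup>2 * ((sin x)\<^sup>2 + (cos x)\<^sup>2)"
      by (simp add: power2_eq_square algebra_simps del: sin_cos_squared_add sin_cos_squared_add3)
    finally show ?thesis
      by simp
  qed
  have "cmod (of_real r * cis x) < 1"
    using r by (simp add: norm_mult)
  then have nz: "1 + of_real r * cis x \<noteq> 0"
    by (metis add_eq_0_iff norm_minus_cancel norm_one less_irrefl)
  \<comment> \<open>By the quadratic equation for r, the factor \<open>(r + 2) / 2\<close> is 1 / (2
    r).\<close>
  have "sqrt 2 + cos x = (r + 2) / 2 * (1 + r\<^sup>2 + 2 * r * cos x)"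
  proof -
    have "(r + 2) / 2 * (1 + r\<^sup>2 + 2 * r * cos x) = (r + 2) * (1 - r) + (r + 2) * r * cos x"
      unfolding r(1) by (simp add: field_simps)
    also have "\<dots> = (2 - r - r\<^sup>2) + (r\<^sup>2 + 2 * r) * cos x"
      by (simp add: power2_eq_square algebra_simps)
    also have "\<dots> = sqrt 2 + cos x"
      unfolding r(1) by (simp add: r_def)
    finally show ?thesis by simp
  qed
  also have "ln \<dots> = ln ((r + 2) / 2) + ln ((cmod (1 + of_real r * cis x))\<^sup>2)"
    unfolding n[symmetric] using r nz by (intro ln_mult_pos) auto
  also have "ln ((cmod (1 + of_real r * cis x))\<^sup>2) = 2 * ln (cmod (1 + of_real r * cis x))"
    using nz by (simp add: ln_realpow)
  finally show ?thesis
    unfolding y r_def[symmetric] .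
qed

text \<open>The interval is split at pi, where \<open>cos (\<phi> / 2)\<close> changes sign. Each
  half is a quarter circle running between a real point, which contributes 0, and i r.\<close>

lemma has_integral_ln_sqrt2_plus_abs_cos:
  "((\<lambda>\<phi>. ln (sqrt 2 + \<bar>cos (\<phi> / 2)\<bar>)) has_integral
    2 * pi * ln ((1 + sqrt 2) / 2) + 8 * Im (Li2 (of_real (sqrt 2 - 1) * \<i>))) {0..2 * pi}"
proof -
  define r where "r = sqrt 2 - 1"
  define L where "L = ln ((1 + sqrt 2) / 2)"
  define T where "T = Im (Li2 (of_real r * \<i>))"
  have r: "0 < r" "r < 1"
    by (auto simp: r_def sqrt2_less_2 less_diff_eq)
  have real: "Im (Li2 (of_real r)) = 0" "Im (Li2 (- of_real r)) = 0"
    using Im_Li2_real[of r] Im_Li2_real[of "- r"] r by auto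
  \<comment> \<open>The frequency is negative so that the arc starting at -r ends at i r, not at -i
    r.\<close>
  have "((\<lambda>\<phi>. L + 2 * ln (cmod (1 - (- of_real r) * cis (- 1 / 2 * \<phi>)))) has_integral
      pi * L + 4 * T) {0..pi}"
    using has_integral_add[OF has_integral_const_real[of L 0 pi] has_integral_mult_right[OF
        has_integral_ln_cmod_one_minus_cis[of "- of_real r" "- 1 / 2" 0 pi], of 2]] r real
    by (simp add: T_def cis_minus_pi_half)
  moreover have "L + 2 * ln (cmod (1 - (- of_real r) * cis (- 1 / 2 * \<phi>))) =
      ln (sqrt 2 + \<bar>cos (\<phi> / 2)\<bar>)" if "\<phi> \<in> {0..pi}" for \<phi>
  proof -
    have "0 \<le> cos (\<phi> / 2)"
      using that by (intro cos_ge_zero) auto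
    then show ?thesis
      using ln_sqrt2_plus_cos[of "- 1 / 2 * \<phi>"] by (simp add: L_def r_def cis_def algebra_simps)
  qed
  ultimately have I1: "((\<lambda>\<phi>. ln (sqrt 2 + \<bar>cos (\<phi> / 2)\<bar>)) has_integral pi * L + 4 * T) {0..pi}"
    by (rule has_integral_eq[rotated])
  have "((\<lambda>\<phi>. L + 2 * ln (cmod (1 - of_real r * cis (1 / 2 * \<phi>)))) has_integral
      pi * L + 4 * T) {pi..2 * pi}"
    using has_integral_add[OF has_integral_const_real[of L pi "2 * pi"] has_integral_mult_right[OF
        has_integral_ln_cmod_one_minus_cis[of "of_real r" "1 / 2" pi "2 * pi"], of 2]] r real
    by (simp add: T_def)
  moreover have "L + 2 * ln (cmod (1 - of_real r * cis (1 / 2 * \<phi>))) =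
      ln (sqrt 2 + \<bar>cos (\<phi> / 2)\<bar>)" if "\<phi> \<in> {pi..2 * pi}" for \<phi>
  proof -
    \<comment> \<open>Shifting the angle by pi makes the cosine nonnegative and turns the factor 1 +
      r cis into 1 - r cis.\<close>
    have "0 \<le> cos (\<phi> / 2 - pi)"
      using that by (intro cos_ge_zero) auto
    moreover have "cos (\<phi> / 2 - pi) = - cos (\<phi> / 2)"
      by (simp add: cos_diff)
    moreover have "cis (\<phi> / 2 - pi) = - cis (\<phi> / 2)"
      by (simp add: complex_eq_iff cos_diff sin_diff)
    ultimately show ?thesis
      using ln_sqrt2_plus_cos[of "\<phi> / 2 - pi"] by (simp add: L_def r_def)
  qed
  ultimately have "((\<lambda>\<phi>. ln (sqrt 2 + \<bar>cos (\<phi> / 2)\<bar>)) has_integral pi * L + 4 * T) {pi..2 * pi}"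
    by (rule has_integral_eq[rotated])
  from has_integral_combine[OF _ _ I1 this] show ?thesis
    by (simp add: L_def T_def r_def algebra_simps)
qed

text \<open>The integrand has a singularity at \<^term>\<open>(pi, pi)\<close>, so Tonelli's theorem is applied to the
  nonnegative function \<^term>\<open>ln 32 - f x\<close> (note that \<^term>\<open>ln 0 = (0::real)\<close>).\<close>

lemma mahler2_pC1:
  "2 * pi * mahler2 pC1 = 4 * pi * ln (1 + sqrt 2) + 16 * Im (Li2 (of_real (sqrt 2 - 1) * \<i>))"
proof -
  define T where "T = Im (Li2 (of_real (sqrt 2 - 1) * \<i>))"
  define B :: "(real \<times> real) set" where "B = {0..2 * pi} \<times> {0..2 * pi}"
  define f where "f = (\<lambda>x::real \<times> real. ln (cmod (pC1 (cis (fst x)) (cis (snd x)))))"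
  define h where "h = (\<lambda>\<phi>. 2 * pi * ln 32 - 4 * pi * (ln 2 + ln (sqrt 2 + \<bar>cos (\<phi> / 2)\<bar>)))"
  define V where "V = 2 * pi * (2 * pi * ln 32) -
    4 * pi * (2 * pi * ln 2 + (2 * pi * ln ((1 + sqrt 2) / 2) + 8 * T))"
  have f_le: "f x \<le> ln 32" for x
  proof (cases "cmod (pC1 (cis (fst x)) (cis (snd x))) = 0")
    case False
    then show ?thesis
      unfolding f_def by (intro ln_mono cmod_pC1_cis_le) auto
  qed (simp add: f_def)
  have "continuous_on UNIV (\<lambda>x::real \<times> real. pC1 (cis (fst x)) (cis (snd x)))"
    unfolding pC1_def by (intro continuous_intros)
  then have [measurable]: "(\<lambda>x::real \<times> real. pC1 (cis (fst x)) (cis (snd x))) \<in> borel_measurable borel"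
    by (rule borel_measurable_continuous_onI)
  have f_meas [measurable]: "f \<in> borel_measurable borel"
    unfolding f_def by measurable
  have B_meas [measurable]: "B \<in> sets borel"
    unfolding B_def by (intro borel_closed closed_Times closed_atLeastAtMost)
  \<comment> \<open>Nonnegativity holds because 2 pi ln 32 = 10 pi ln 2 and the subtracted term is
    at most 4 pi (ln 2 + (3/2) ln 2).\<close>
  have h_nonneg: "0 \<le> h \<phi>" for \<phi>
  proof -
    have "sqrt 2 + \<bar>cos (\<phi> / 2)\<bar> \<le> 2 * sqrt 2"
      using order.trans[OF abs_cos_le_one, of "sqrt 2" "\<phi> / 2"] by simp
    then have "ln (sqrt 2 + \<bar>cos (\<phi> / 2)\<bar>) \<le> ln (2 * sqrt 2)"
      by (intro ln_mono) (auto intro!: add_pos_nonneg)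
    also have "\<dots> = 3 / 2 * ln 2"
      by (simp add: ln_mult ln_sqrt)
    finally have "0 \<le> 4 * pi * (3 / 2 * ln 2 - ln (sqrt 2 + \<bar>cos (\<phi> / 2)\<bar>))"
      by simp
    moreover have "ln (32::real) = 5 * ln 2"
      using ln_realpow[of 2 5] by simp
    ultimately show ?thesis
      unfolding h_def by (simp add: algebra_simps)
  qed
  \<comment> \<open>At \<phi> = pi the two coefficients coincide and the linear factor vanishes at
    \<theta> = pi, so Jensen's formula in its strict form does not apply. This slice is null and
    drops out of the outer integral.\<close>
  have inner: "(\<integral>\<^sup>+\<theta>. ennreal (indicator B (\<theta>, \<phi>) * (ln 32 - f (\<theta>, \<phi>))) \<partial>lborel) =
      ennreal (indicator {0..2 * pi} \<phi> * h \<phi>)" if "\<phi> \<noteq> pi" for \<phi>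
  proof (cases "\<phi> \<in> {0..2 * pi}")
    case True
    have "cos (\<phi> / 2) \<noteq> 0"
    proof
      assume "cos (\<phi> / 2) = 0"
      moreover have "0 \<le> \<phi> / 2" "\<phi> / 2 \<le> pi"
        using True by auto
      ultimately have "\<phi> / 2 = pi / 2"
        using cos_inj_pi[of "\<phi> / 2" "pi / 2"] by simp
      then show False
        using that by simp
    qed
    from has_integral_diff[OF has_integral_const_real[of "ln 32" 0 "2 * pi"]
        has_integral_ln_cmod_pC1[OF this]]
    have "((\<lambda>\<theta>. ln 32 - f (\<theta>, \<phi>)) has_integral h \<phi>) {0..2 * pi}"
      by (simp add: f_def h_def)
    then have "(\<integral>\<^sup>+\<theta>. ennreal (indicator {0..2 * pi} \<theta> * (ln 32 - f (\<theta>, \<phi>))) \<partial>lborel) = ennreal (h \<phi>)"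
      by (intro nn_integral_has_integral_lebesgue) (use f_le in auto)
    moreover have "indicator B (\<theta>, \<phi>) = (indicator {0..2 * pi} \<theta> :: real)" for \<theta>
      using True by (auto simp: B_def indicator_def)
    ultimately show ?thesis
      using True by simp
  next
    case False
    then have "indicator B (\<theta>, \<phi>) = (0 :: real)" for \<theta>
      by (auto simp: B_def)
    then show ?thesis
      using False by simp
  qed
  have "(h has_integral V) {0..2 * pi}"
    using has_integral_diff[OF has_integral_const_real[of "2 * pi * ln 32" 0 "2 * pi"]
        has_integral_mult_right[OF has_integral_add[OF has_integral_const_real[of "ln 2" 0 "2 * pi"]
          has_integral_ln_sqrt2_plus_abs_cos], of "4 * pi"]]
    by (simp add: h_def V_def T_def)
  then have outer: "(\<integral>\<^sup>+\<phi>. ennreal (indicator {0..2 * pi} \<phi> * h \<phi>) \<partial>lborel) = ennreal V"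
    and V_nonneg: "0 \<le> V"
    using h_nonneg by (auto intro!: nn_integral_has_integral_lebesgue intro: has_integral_nonneg)
  have "(\<integral>\<^sup>+x. ennreal (indicator B x * (ln 32 - f x)) \<partial>lborel) =
      (\<integral>\<^sup>+x. ennreal (indicator B x * (ln 32 - f x)) \<partial>(lborel \<Otimes>\<^sub>M lborel))"
    by (simp add: lborel_prod)
  also have "\<dots> =
      (\<integral>\<^sup>+\<phi>. \<integral>\<^sup>+\<theta>. ennreal (indicator B (\<theta>, \<phi>) * (ln 32 - f (\<theta>, \<phi>))) \<partial>lborel \<partial>lborel)"
    by (intro lborel_pair.nn_integral_snd[symmetric]) (simp add: lborel_prod)
  also have "\<dots> = (\<integral>\<^sup>+\<phi>. ennreal (indicator {0..2 * pi} \<phi> * h \<phi>) \<partial>lborel)"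
    by (intro nn_integral_cong_AE)
       (use AE_lborel_singleton[of pi] in \<open>auto elim!: eventually_mono intro: inner\<close>)
  finally have "(\<integral>\<^sup>+x. ennreal (indicator B x * (ln 32 - f x)) \<partial>lborel) = ennreal V"
    by (simp add: outer)
  then have 1: "has_bochner_integral lborel (\<lambda>x. indicator B x * (ln 32 - f x)) V"
    using V_nonneg f_le by (intro has_bochner_integral_nn_integral) auto
  have "B = cbox (0, 0) (2 * pi, 2 * pi)"
    by (simp add: B_def cbox_Pair_eq)
  then have "measure lborel B = (2 * pi) * (2 * pi)" "emeasure lborel B < \<infinity>"
    using emeasure_lborel_cbox_finite by (auto simp: content_Pair)
  then have "has_bochner_integral lborel (\<lambda>x. indicator B x * ln 32) ((2 * pi) * (2 * pi) * ln 32)"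
    using has_bochner_integral_mult_left[OF has_bochner_integral_real_indicator[of B lborel], of "ln 32"]
    by simp
  \<comment> \<open>Subtracting from the integrable constant \<open>ln 32\<close> on the square
    yields both integrability and the integral of the signed function.\<close>
  from has_bochner_integral_diff[OF this 1]
  have "has_bochner_integral lborel (\<lambda>x. indicator B x * f x) ((2 * pi) * (2 * pi) * ln 32 - V)"
    by (simp add: algebra_simps)
  then have "mahler2 pC1 = 1 / (4 * pi\<^sup>2) * ((2 * pi) * (2 * pi) * ln 32 - V)"
    unfolding mahler2_def f_def B_def by (simp add: has_bochner_integral_integral_eq)
  moreover have "ln ((1 + sqrt 2) / 2) = ln (1 + sqrt 2) - ln 2"
    by (rule ln_divide_pos) (auto intro: add_pos_pos)
  ultimately have "mahler2 pC1 = 1 / (4 * pi\<^sup>2) * (2 * pi * (4 * pi * ln (1 + sqrt 2) + 16 * T))"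
    unfolding V_def by (simp add: power2_eq_square algebra_simps)
  then show ?thesis
    unfolding T_def[symmetric] by (simp add: power2_eq_square)
qed

subsection \<open>The inversion formula and numerical bounds\<close>

lemma BW_imaginary:
  "BW (of_real y * \<i>) = Im (Li2 (of_real y * \<i>)) - arctan y * ln \<bar>y\<bar>"
  by (simp add: BW_def norm_mult Arg_one_minus_imaginary)

text \<open>The difference of the two sides has derivative (arctan t + arctan (1 / t) - pi / 2) / t
  = 0 and vanishes at 1.\<close>

lemma Im_Li2_imaginary_inverse:
  assumes "1 \<le> y"
  shows "Im (Li2 (of_real y * \<i>)) = Im (Li2 (of_real (1 / y) * \<i>)) + pi / 2 * ln y"
proof (cases "y = 1")
  case True
  then show ?thesis by simp
next
  case False
  define T where "T = (\<lambda>y. Im (Li2 (of_real y * \<i>)))"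
  define g where "g = (\<lambda>y. T y - T (1 / y) - pi / 2 * ln y)"
  have T: "(T has_real_derivative arctan t / t) (at t)" if "t \<noteq> 0" for t
    unfolding T_def by (rule has_real_derivative_Im_Li2_imaginary[OF that])
  have g: "(g has_real_derivative 0) (at t)" if "0 < t" for t
  proof -
    have "((\<lambda>y. 1 / y) has_real_derivative - (1 / t\<^sup>2)) (at t)"
      using that by (auto intro!: derivative_eq_intros simp: power2_eq_square)
    moreover have "(T has_real_derivative arctan (1 / t) * t) (at (1 / t))"
      using T[of "1 / t"] that by simp
    ultimately have "((\<lambda>y. T (1 / y)) has_real_derivative (arctan (1 / t) * t) * - (1 / t\<^sup>2)) (at t)"
      by (rule DERIV_chain2[rotated])
    then have "(g has_real_derivative
        arctan t / t - (arctan (1 / t) * t) * - (1 / t\<^sup>2) - pi / 2 * (1 / t)) (at t)"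
      unfolding g_def using that by (intro DERIV_diff DERIV_cmult T DERIV_ln_divide) auto
    also have "arctan (1 / t) = pi / 2 - arctan t"
      using arctan_inverse[of t] that by (simp add: inverse_eq_divide)
    also have "arctan t / t - ((pi / 2 - arctan t) * t) * - (1 / t\<^sup>2) - pi / 2 * (1 / t) = 0"
      using that by (simp add: field_simps power2_eq_square)
    finally show ?thesis .
  qed
  have "g y = g 1"
    using assms False by (intro DERIV_isconst_end) (auto intro!: g DERIV_continuous_on[of _ g "\<lambda>_. 0"]
        intro: has_field_derivative_at_within)
  then show ?thesis
    by (simp add: g_def T_def)
qed

text \<open>With y = 1 + sqrt 2 one has 1 / y = sqrt 2 - 1 and arctan y = 3 pi / 8. Inversion and
  the log term of \<open>BW\<close> together leave (pi / 8) ln y, and 16 times this accounts for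
  half of 4 pi ln y.\<close>

lemma mahler2_pC1_BW:
  "2 * pi * mahler2 pC1 = 16 * BW ((1 + sqrt 2) * \<i>) + 2 * pi * ln (1 + sqrt 2)"
proof -
  define y where "y = 1 + sqrt 2"
  have "(sqrt 2 - 1) * (1 + sqrt 2) = 1"
    by (simp add: algebra_simps)
  then have y: "1 \<le> y" "1 / y = sqrt 2 - 1"
    by (auto simp: y_def divide_eq_eq add_pos_pos add_nonneg_eq_0_iff)
  have "arctan y = 3 * pi / 8"
  proof -
    \<comment> \<open>The double-angle formula gives arctan (sqrt 2 - 1) = pi / 8; its complement is
      arctan y.\<close>
    have "2 * (sqrt 2 - 1) / (1 - (sqrt 2 - 1)\<^sup>2) = 1"
      by (simp add: power2_eq_square algebra_simps)
    moreover have "\<bar>sqrt 2 - 1\<bar> < 1"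
      using sqrt2_less_2 by (simp add: abs_less_iff)
    ultimately have "2 * arctan (sqrt 2 - 1) = arctan 1"
      by (metis arctan_double)
    then have "arctan (1 / y) = pi / 8"
      by (simp add: y(2) arctan_one)
    then show ?thesis
      using arctan_inverse[of y] y(1) by (simp add: inverse_eq_divide)
  qed
  then have "BW (of_real y * \<i>) = Im (Li2 (of_real (sqrt 2 - 1) * \<i>)) + pi / 2 * ln y - 3 * pi / 8 * ln y"
    using Im_Li2_imaginary_inverse[OF y(1)] y by (simp add: BW_imaginary)
  then have "16 * BW (of_real y * \<i>) + 2 * pi * ln y = 2 * pi * mahler2 pC1"
    unfolding mahler2_pC1 y_def[symmetric] by (simp add: algebra_simps)
  then show ?thesis
    by (simp add: y_def)
qed

section \<open>Polynomial bounds by comparison of derivatives\<close>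

text \<open>Derivatives are compared only in the open interval, which keeps quotients such as
  \<open>arctan t / t\<close> away from 0.\<close>

lemma le_if_derivative_le:
  fixes f g :: "real \<Rightarrow> real"
  assumes "a \<le> b" "f a \<le> g a"
    and "continuous_on {a..b} f" "continuous_on {a..b} g"
    and "\<And>x. a < x \<Longrightarrow> x < b \<Longrightarrow> (f has_real_derivative f' x) (at x)"
    and "\<And>x. a < x \<Longrightarrow> x < b \<Longrightarrow> (g has_real_derivative g' x) (at x)"
    and "\<And>x. a < x \<Longrightarrow> x < b \<Longrightarrow> f' x \<le> g' x"
  shows "f b \<le> g b"
proof -
  have "(\<lambda>x. g x - f x) a \<le> (\<lambda>x. g x - f x) b"
  proof (rule DERIV_nonneg_imp_increasing_open[OF assms(1)])
    fix x assume "a < x" "x < b"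
    then show "\<exists>D. ((\<lambda>x. g x - f x) has_real_derivative D) (at x) \<and> 0 \<le> D"
      using assms(5-7) by (intro exI[of _ "g' x - f' x"] conjI DERIV_diff) auto
  qed (intro continuous_intros assms)
  then show ?thesis
    using assms(2) by simp
qed

text \<open>Halving the last coefficient of the cubic Taylor polynomial makes the upper bound exact
  at x = 1, so few terms suffice at that endpoint, where the series converges slowly.\<close>

lemma inverse_one_plus_le:
  fixes x :: real
  assumes "0 \<le> x" "x \<le> 1"
  shows "1 / (1 + x) \<le> 1 - x + x\<^sup>2 - x ^ 3 / 2"
proof -
  have "(1 - x + x\<^sup>2 - x ^ 3 / 2) * (1 + x) = 1 + x ^ 3 * (1 - x) / 2"
    by (simp add: field_simps power2_eq_square power3_eq_cube)
  moreover have "0 \<le> x ^ 3 * (1 - x) / 2"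
    using assms by simp
  ultimately show ?thesis
    using assms by (simp add: divide_le_eq)
qed

lemma continuous_on_Im_Li2_imaginary: "continuous_on A (\<lambda>t. Im (Li2 (of_real t * \<i>)))"
  by (intro continuous_on_Im_Li2_ray) simp

text \<open>The majorant of 1 / (1 + x) at x = t^2, integrated term by term; the halved coefficient
  yields 14 = 2 * 7.\<close>

lemma arctan_le:
  assumes "0 \<le> x" "x \<le> 1"
  shows "arctan x \<le> x - x ^ 3 / 3 + x ^ 5 / 5 - x ^ 7 / 14"
proof (rule le_if_derivative_le[OF assms(1), of arctan _ "\<lambda>x. 1 / (1 + x\<^sup>2)"
      "\<lambda>x. 1 - x\<^sup>2 + (x\<^sup>2)\<^sup>2 - (x\<^sup>2) ^ 3 / 2"])
  fix t assume "0 < t" "t < x"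
  then show "1 / (1 + t\<^sup>2) \<le> 1 - t\<^sup>2 + (t\<^sup>2)\<^sup>2 - (t\<^sup>2) ^ 3 / 2"
    using assms by (intro inverse_one_plus_le) (auto simp: power_le_one)
qed (auto intro!: continuous_intros derivative_eq_intros simp: inverse_eq_divide)

lemma arctan_ge:
  assumes "0 \<le> x"
  shows "x - x ^ 3 / 3 \<le> arctan x"
proof (rule le_if_derivative_le[OF assms, of _ arctan "\<lambda>x. 1 - x\<^sup>2" "\<lambda>x. 1 / (1 + x\<^sup>2)"])
  fix t assume "0 < t" "t < x"
  have "(1 - t\<^sup>2) * (1 + t\<^sup>2) \<le> 1"
    by (simp add: algebra_simps)
  then show "1 - t\<^sup>2 \<le> 1 / (1 + t\<^sup>2)"
    by (simp add: pos_le_divide_eq add_pos_nonneg)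
qed (auto intro!: continuous_intros derivative_eq_intros simp: inverse_eq_divide)

text \<open>This value is Catalan's constant, bounded by dividing the arctangent majorant by t and
  integrating once more.\<close>

lemma Im_Li2_ii_le: "Im (Li2 \<i>) \<le> 1 - 1 / 9 + 1 / 25 - 1 / 98"
proof -
  have "Im (Li2 (of_real 1 * \<i>)) \<le> 1 - 1 ^ 3 / 9 + 1 ^ 5 / 25 - 1 ^ 7 / 98"
  proof (rule le_if_derivative_le[where a = 0 and f' = "\<lambda>t. arctan t / t" and
        g' = "\<lambda>t. 1 - t\<^sup>2 / 3 + t ^ 4 / 5 - t ^ 6 / 14" and
        f = "\<lambda>t. Im (Li2 (of_real t * \<i>))" and g = "\<lambda>t. t - t ^ 3 / 9 + t ^ 5 / 25 - t ^ 7 / 98"])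
    fix t :: real assume t: "0 < t" "t < 1"
    show "((\<lambda>t. Im (Li2 (of_real t * \<i>))) has_real_derivative arctan t / t) (at t)"
      using t by (intro has_real_derivative_Im_Li2_imaginary) auto
    have "arctan t / t \<le> (t - t ^ 3 / 3 + t ^ 5 / 5 - t ^ 7 / 14) / t"
      using t by (intro divide_right_mono arctan_le) auto
    also have "\<dots> = 1 - t\<^sup>2 / 3 + t ^ 4 / 5 - t ^ 6 / 14"
      using t by (simp add: field_simps eval_nat_numeral)
    finally show "arctan t / t \<le> 1 - t\<^sup>2 / 3 + t ^ 4 / 5 - t ^ 6 / 14" .
  qed (auto intro!: continuous_on_Im_Li2_imaginary continuous_on_diff continuous_on_add
      continuous_on_divide continuous_on_power continuous_on_id derivative_eq_intros)
  then show ?thesis by simp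
qed

lemma Im_Li2_imaginary_ge:
  assumes "0 \<le> y"
  shows "y - y ^ 3 / 9 \<le> Im (Li2 (of_real y * \<i>))"
proof (rule le_if_derivative_le[OF assms, where g' = "\<lambda>t. arctan t / t" and
      f' = "\<lambda>t. 1 - t\<^sup>2 / 3" and
      g = "\<lambda>t. Im (Li2 (of_real t * \<i>))" and f = "\<lambda>t. t - t ^ 3 / 9"])
  fix t :: real assume t: "0 < t" "t < y"
  show "((\<lambda>t. Im (Li2 (of_real t * \<i>))) has_real_derivative arctan t / t) (at t)"
    using t by (intro has_real_derivative_Im_Li2_imaginary) auto
  have "1 - t\<^sup>2 / 3 = (t - t ^ 3 / 3) / t"
    using t by (simp add: field_simps eval_nat_numeral)
  also have "\<dots> \<le> arctan t / t"
    using t by (intro divide_right_mono arctan_ge) auto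
  finally show "1 - t\<^sup>2 / 3 \<le> arctan t / t" .
qed (auto intro!: continuous_on_Im_Li2_imaginary continuous_on_diff continuous_on_add
      continuous_on_divide continuous_on_power continuous_on_id derivative_eq_intros)

text \<open>The derivative of the left-hand side is \<^term>\<open>sqrt 3 / 2 * ((1 + s) / (1 + s ^ 3))\<close>; the bound
  integrates the polynomial majorant of \<^term>\<open>1 / (1 + s ^ 3)\<close> term by term.\<close>

lemma neg_Arg_one_minus_ray_le:
  fixes s :: real
  assumes "0 \<le> s" "s \<le> 1"
  shows "- Arg (1 - of_real s * cis (pi / 3)) \<le>
    sqrt 3 / 2 * (s + s\<^sup>2 / 2 - s ^ 4 / 4 - s ^ 5 / 5 + s ^ 7 / 7 + s ^ 8 / 8 - s ^ 10 / 20 - s ^ 11 / 22)"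
proof -
  \<comment> \<open>The real part 1 - t / 2 is positive here, so the argument is an
    arctangent.\<close>
  have Arg: "- Arg (1 - of_real t * cis (pi / 3)) = arctan (sqrt 3 * t / (2 - t))" if "t \<le> 1" for t
  proof -
    have "Im (1 - of_real t * cis (pi / 3)) / Re (1 - of_real t * cis (pi / 3)) =
        - (sqrt 3 * t / (2 - t))"
      using that by (simp add: sin_60 cos_60 field_simps)
    moreover have "Arg (1 - of_real t * cis (pi / 3)) =
        arctan (Im (1 - of_real t * cis (pi / 3)) / Re (1 - of_real t * cis (pi / 3)))"
      using that by (intro arg_conv_arctan) (simp add: cos_60)
    ultimately show ?thesis
      by (simp add: arctan_minus)
  qed
  have "arctan (sqrt 3 * s / (2 - s)) \<le>
    sqrt 3 / 2 * (s + s\<^sup>2 / 2 - s ^ 4 / 4 - s ^ 5 / 5 + s ^ 7 / 7 + s ^ 8 / 8 - s ^ 10 / 20 - s ^ 11 / 22)"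
  proof (rule le_if_derivative_le[OF assms(1), where
        f = "\<lambda>t. arctan (sqrt 3 * t / (2 - t))" and f' = "\<lambda>t. sqrt 3 / 2 * ((1 + t) * (1 / (1 + t ^ 3)))" and
        g = "\<lambda>s. sqrt 3 / 2 * (s + s\<^sup>2 / 2 - s ^ 4 / 4 - s ^ 5 / 5 + s ^ 7 / 7 + s ^ 8 / 8
               - s ^ 10 / 20 - s ^ 11 / 22)" and
        g' = "\<lambda>t. sqrt 3 / 2 * ((1 + t) * (1 - t ^ 3 + (t ^ 3)\<^sup>2 - (t ^ 3) ^ 3 / 2))"])
    fix t assume t: "0 < t" "t < s"
    have nz: "1 + (sqrt 3 * t / (2 - t))\<^sup>2 = 4 * (1 - t + t\<^sup>2) / (2 - t)\<^sup>2"
    proof -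
      have "(2 - t)\<^sup>2 \<noteq> 0"
        using t assms by simp
      moreover have "(2 - t)\<^sup>2 + 3 * t\<^sup>2 = 4 * (1 - t + t\<^sup>2)"
        by (simp add: power2_eq_square algebra_simps)
      moreover have "1 + (sqrt 3 * t / (2 - t))\<^sup>2 = 1 + 3 * t\<^sup>2 / (2 - t)\<^sup>2"
        by (simp add: power_divide power_mult_distrib)
      ultimately show ?thesis
        by (metis add_divide_distrib divide_self)
    qed
    have "((\<lambda>t. sqrt 3 * t / (2 - t)) has_real_derivative 2 * sqrt 3 / (2 - t)\<^sup>2) (at t)"
      using t assms by (auto intro!: derivative_eq_intros simp: field_simps power2_eq_square)
    from DERIV_chain2[OF DERIV_arctan this]
    have "((\<lambda>t. arctan (sqrt 3 * t / (2 - t))) has_real_derivative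
        inverse (1 + (sqrt 3 * t / (2 - t))\<^sup>2) * (2 * sqrt 3 / (2 - t)\<^sup>2)) (at t)" .
    also have "inverse (1 + (sqrt 3 * t / (2 - t))\<^sup>2) * (2 * sqrt 3 / (2 - t)\<^sup>2) =
        sqrt 3 / 2 * (1 / (1 - t + t\<^sup>2))"
    proof -
      have *: "inverse (4 * q / d) * (2 * a / d) = a / 2 * (1 / q)" if "d \<noteq> 0" for a d q :: real
        using that by (cases "q = 0") (simp_all add: field_simps)
      show ?thesis
        unfolding nz using t assms by (intro *) simp
    qed
    \<comment> \<open>Multiplying through by 1 + t turns the denominator into 1 + t^3, so the
      earlier majorant applies at x = t^3.\<close>
    also have "1 / (1 - t + t\<^sup>2) = (1 + t) * (1 / (1 + t ^ 3))"
    proof -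
      have "1 + t ^ 3 = (1 + t) * (1 - t + t\<^sup>2)"
        by (simp add: power2_eq_square power3_eq_cube algebra_simps)
      then show ?thesis
        using t by simp
    qed
    finally show "((\<lambda>t. arctan (sqrt 3 * t / (2 - t))) has_real_derivative
        sqrt 3 / 2 * ((1 + t) * (1 / (1 + t ^ 3)))) (at t)" .
    show "sqrt 3 / 2 * ((1 + t) * (1 / (1 + t ^ 3))) \<le>
        sqrt 3 / 2 * ((1 + t) * (1 - t ^ 3 + (t ^ 3)\<^sup>2 - (t ^ 3) ^ 3 / 2))"
      using t assms by (intro mult_left_mono inverse_one_plus_le) (auto simp: power_le_one)
    show "((\<lambda>s. sqrt 3 / 2 * (s + s\<^sup>2 / 2 - s ^ 4 / 4 - s ^ 5 / 5 + s ^ 7 / 7 + s ^ 8 / 8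
         - s ^ 10 / 20 - s ^ 11 / 22)) has_real_derivative
         sqrt 3 / 2 * ((1 + t) * (1 - t ^ 3 + (t ^ 3)\<^sup>2 - (t ^ 3) ^ 3 / 2))) (at t)"
      by (rule DERIV_cmult) (auto intro!: derivative_eq_intros simp: field_simps eval_nat_numeral)
  qed (use assms in \<open>auto intro!: continuous_intros\<close>)
  then show ?thesis
    by (simp add: Arg assms(2))
qed

text \<open>A second integration along the ray squares the index in each denominator; the last two,
  200 and 242, are 2 * 10^2 and 2 * 11^2.\<close>

lemma Im_Li2_cis_60_le:
  "Im (Li2 (cis (pi / 3))) \<le>
    sqrt 3 / 2 * (1 + 1 / 4 - 1 / 16 - 1 / 25 + 1 / 49 + 1 / 64 - 1 / 200 - 1 / 242)"
proof -
  define g where "g = (\<lambda>s::real. sqrt 3 / 2 *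
    (s + s\<^sup>2 / 4 - s ^ 4 / 16 - s ^ 5 / 25 + s ^ 7 / 49 + s ^ 8 / 64 - s ^ 10 / 200 - s ^ 11 / 242))"
  define g' where "g' = (\<lambda>s::real. sqrt 3 / 2 *
    (1 + s / 2 - s ^ 3 / 4 - s ^ 4 / 5 + s ^ 6 / 7 + s ^ 7 / 8 - s ^ 9 / 20 - s ^ 10 / 22))"
  have dom: "of_real s * cis (pi / 3) \<in> Li2_domain" if "s < 2" for s :: real
    using that by (intro Li2_domainI_Re) (simp add: cos_60)
  have "Im (Li2 (of_real 1 * cis (pi / 3))) \<le> g 1"
  proof (rule le_if_derivative_le[where a = 0 and f = "\<lambda>s. Im (Li2 (of_real s * cis (pi / 3)))" and
        f' = "\<lambda>s. - Arg (1 - of_real s * cis (pi / 3)) / s" and g' = g'])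
    fix s :: real assume s: "0 < s" "s < 1"
    show "((\<lambda>s. Im (Li2 (of_real s * cis (pi / 3)))) has_real_derivative
        - Arg (1 - of_real s * cis (pi / 3)) / s) (at s)"
      using s by (intro has_real_derivative_Im_Li2_ray dom) auto
    have "- Arg (1 - of_real s * cis (pi / 3)) / s \<le> (sqrt 3 / 2 *
        (s + s\<^sup>2 / 2 - s ^ 4 / 4 - s ^ 5 / 5 + s ^ 7 / 7 + s ^ 8 / 8 - s ^ 10 / 20 - s ^ 11 / 22)) / s"
      using s by (intro divide_right_mono neg_Arg_one_minus_ray_le) auto
    also have "\<dots> = g' s"
      using s by (simp add: g'_def field_simps eval_nat_numeral)
    finally show "- Arg (1 - of_real s * cis (pi / 3)) / s \<le> g' s" .
    show "(g has_real_derivative g' s) (at s)"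
      unfolding g_def g'_def
      by (rule DERIV_cmult) (auto intro!: derivative_eq_intros simp: field_simps eval_nat_numeral)
  qed (auto simp: g_def intro!: continuous_on_Im_Li2_ray dom continuous_on_diff continuous_on_add
      continuous_on_divide continuous_on_mult continuous_on_power continuous_on_id continuous_on_const)
  then show ?thesis
    by (simp add: g_def)
qed

section \<open>The numerical inequality\<close>

text \<open>On the unit circle the log term of \<open>BW\<close> vanishes.\<close>

lemma v_tet_eq: "v_tet = Im (Li2 (cis (pi / 3)))"
  by (simp add: v_tet_def BW_def)

lemma v_oct_eq: "v_oct = 4 * Im (Li2 \<i>)"
  by (simp add: v_oct_def BW_def)

lemma sqrt2_bounds: "141421 / 100000 \<le> sqrt 2" "sqrt 2 \<le> 141422 / 100000"
  by (rule real_le_rsqrt real_le_lsqrt; simp add: power2_eq_square)+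

text \<open>In the series ln x = 2 artanh ((x - 1) / (x + 1)) the argument at x = 1 + sqrt 2 is sqrt
  2 - 1; three terms already exceed 22/25.\<close>

lemma ln_one_plus_sqrt2_ge: "22 / 25 \<le> ln (1 + sqrt 2)"
proof -
  have "sqrt 2 = (sqrt 2 - 1) * (sqrt 2 + 2)"
    by (simp add: algebra_simps)
  moreover have "sqrt 2 + 2 \<noteq> 0"
    by (smt (verit) real_sqrt_ge_zero)
  ultimately have r: "sqrt 2 / (sqrt 2 + 2) = sqrt 2 - 1"
    by (metis nonzero_mult_div_cancel_right)
  have ge: "41421 / 100000 \<le> sqrt 2 - 1"
    using sqrt2_bounds by linarith
  have "(22 / 25 :: real) \<le> (\<Sum>k<3. 2 * (41421 / 100000) ^ (2 * k + 1) / real (2 * k + 1))"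
    by (simp add: eval_nat_numeral)
  also have "\<dots> \<le> (\<Sum>k<3. 2 * (sqrt 2 - 1) ^ (2 * k + 1) / real (2 * k + 1))"
    using ge by (intro sum_mono divide_right_mono mult_left_mono power_mono) auto
  also have "\<dots> \<le> ln (1 + sqrt 2)"
  proof -
    have "(1 + sqrt 2 - 1) / (1 + sqrt 2 + 1) = sqrt 2 - 1"
      using r by (simp add: add.commute)
    then show ?thesis
      using ln_approx_bounds[of "1 + sqrt 2" 3] by simp
  qed
  finally show ?thesis .
qed

theorem theorem4p6:
  shows "2 * pi * mahler2 pC1 = 16 * BW ((1 + sqrt 2) * \<i>) + 2 * pi * ln (1 + sqrt 2)
         \<and> 10 * v_tet + 2 * v_oct < 2 * pi * mahler2 pC1"
proof (intro conjI)
  show "2 * pi * mahler2 pC1 = 16 * BW ((1 + sqrt 2) * \<i>) + 2 * pi * ln (1 + sqrt 2)"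
    by (rule mahler2_pC1_BW)
  define r where "r = sqrt 2 - 1"
  have r: "41421 / 100000 \<le> r" "r \<le> 41422 / 100000"
    unfolding r_def using sqrt2_bounds by linarith+
  have "r ^ 3 \<le> (41422 / 100000) ^ 3"
    using r by (intro power_mono) auto
  also have "\<dots> \<le> 72 / 1000"
    by (simp add: power3_eq_cube)
  finally have "16 * (41421 / 100000 - 72 / 9000) \<le> 16 * Im (Li2 (of_real r * \<i>))"
    using Im_Li2_imaginary_ge[OF order.trans[OF _ r(1)]] r by simp
  moreover have "4 * (31415 / 10000) * (22 / 25) \<le> 4 * pi * ln (1 + sqrt 2)"
    using pi_approx ln_one_plus_sqrt2_ge by (intro mult_mono) auto
  \<comment> \<open>The two bounds add up to about 6.499 + 11.058 = 17.557.\<close>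
  ultimately have lower: "17.55 \<le> 2 * pi * mahler2 pC1"
    unfolding mahler2_pC1 r_def[symmetric] by (simp add: power3_eq_cube)
  have "sqrt 3 \<le> 17321 / 10000"
    by (intro real_le_lsqrt) (auto simp: power2_eq_square)
  \<comment> \<open>The two upper bounds give about 10.171 + 7.350 = 17.521, leaving room below
    17.55.\<close>
  then have "10 * v_tet + 2 * v_oct < 17.54"
    using Im_Li2_cis_60_le Im_Li2_ii_le by (simp add: v_tet_eq v_oct_eq)
  with lower show "10 * v_tet + 2 * v_oct < 2 * pi * mahler2 pC1"
    by simp
qed

end
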